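(* There is an absolute constant $c_0$ such that the following holds for every constant $c\ge c_0$. Let $\varepsilon\in(0,1)$ and $p_h\in(0,1)$, let $G$ be a graph on $n$ vertices given by a stream of distinct edges, and let $d_{thr}$ be the largest $d$ such that $\sum_{r\ge d}g_h(r)\ge (c(\log n)/\varepsilon^2)/p_h$, where $g_h$ is defined in the context. For all $d\le d_{thr}$ the algorithm's estimate is the head estimator $\widehat N(d)=\sum_{r\ge d}g_h(r)$, and this estimator satisfies $\mathbf{E}[\widehat N(d)]=N(d)$. Moreover, with probability $>1-1/n$, for all $d\le d_{thr}$, $$|\widehat N(d)-N(d)|\le\varepsilon N(d).$$
   Context: The input is a stream of edges $e_1,\dots,e_m$ with no repetitions, in arbitrary order, each edge a pair of distinct vertices; $G=(V,E)$ with $V=[n]$ is the graph they form, where every vertex occurs in some edge. $d_v$ is the degree of $v$, and $N(d)$ is the number of vertices of degree at least $d$ (degrees $d$ are positive integers). Head sampling. Let $\mathrm{hash}$ be a uniformly random function from $V$ to $[0,1]$ (independent uniform values). Start with $S_h=\emptyset$. For each edge $(u,v)$ of the stream, for $w=u$ and then $w=v$: if $w\in S_h$, increment the counter $\mathrm{ct}_h(w)$; if $w\notin S_h$ and $\mathrm{hash}(w)<p_h$, insert $w$ in $S_h$ and set $\mathrm{ct}_h(w)=1$. At the end of the stream let $C_h(r)$ be the number of vertices in $S_h$ with $\mathrm{ct}_h$ value exactly $r$, and $g_h(r)=C_h(r)/p_h$. The threshold $d_{thr}$ is a random variable; if no $d$ satisfies its defining inequality, there is no $d\le d_{thr}$ and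 the statement about $d\le d_{thr}$ is vacuous. The expectation identity concerns the head estimator $\sum_{r\ge d}g_h(r)$ for a fixed degree $d$ (not conditioned on the event $d\le d_{thr}$). Probability and expectation are over $\mathrm{hash}$. *)

theory Defs
  imports "HOL-Probability.Probability"
begin

text \<open>
  A stream is a list of ordered pairs because the order of the two endpoints determines the
  order in which they are processed; the edges of the graph are the underlying unordered pairs.
\<close>

definition uedge :: "nat \<times> nat \<Rightarrow> nat set" where
  "uedge e = {fst e, snd e}"

definition edge_set :: "(nat \<times> nat) list \<Rightarrow> nat set set" where
  "edge_set es = uedge ` set es"

definition edge_stream :: "nat \<Rightarrow> (nat \<times> nat) list \<Rightarrow> bool" where
  "edge_stream n es \<longleftrightarrow>
     (\<forall>e\<in>set es. fst e \<noteq> snd e) \<and> distinct (map uedge es) \<and> \<Union>(edge_set es) = {1..n}"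

definition vdegree :: "nat set set \<Rightarrow> nat \<Rightarrow> nat" where
  "vdegree E v = card {e \<in> E. v \<in> e}"

definition N_ge :: "nat \<Rightarrow> nat set set \<Rightarrow> nat \<Rightarrow> nat" where
  "N_ge n E d = card {v \<in> {1..n}. d \<le> vdegree E v}"

definition hash_measure :: "nat \<Rightarrow> (nat \<Rightarrow> real) measure" where
  "hash_measure n = (\<Pi>\<^sub>M v\<in>{1..n}. uniform_measure lborel {0..1})"

text \<open>
  The state of head sampling is a partial function: its domain is the sampled set
  \<open>S\<^sub>h\<close> and its values are the counters \<open>ct\<^sub>h\<close>.
\<close>

definition head_visit ::
    "(nat \<Rightarrow> real) \<Rightarrow> real \<Rightarrow> nat \<Rightarrow> (nat \<rightharpoonup> nat) \<Rightarrow> (nat \<rightharpoonup> nat)" where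
  "head_visit h p w st =
     (case st w of
        Some k \<Rightarrow> st(w \<mapsto> k + 1)
      | None \<Rightarrow> if h w < p then st(w \<mapsto> 1) else st)"

definition head_edge ::
    "(nat \<Rightarrow> real) \<Rightarrow> real \<Rightarrow> nat \<times> nat \<Rightarrow> (nat \<rightharpoonup> nat) \<Rightarrow> (nat \<rightharpoonup> nat)" where
  "head_edge h p e st = head_visit h p (snd e) (head_visit h p (fst e) st)"

definition head_sample :: "(nat \<Rightarrow> real) \<Rightarrow> real \<Rightarrow> (nat \<times> nat) list \<Rightarrow> (nat \<rightharpoonup> nat)" where
  "head_sample h p es = fold (head_edge h p) es Map.empty"

definition C_head :: "(nat \<Rightarrow> real) \<Rightarrow> real \<Rightarrow> (nat \<times> nat) list \<Rightarrow> nat \<Rightarrow> nat" where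
  "C_head h p es r = card {w. head_sample h p es w = Some r}"

definition g_head :: "(nat \<Rightarrow> real) \<Rightarrow> real \<Rightarrow> (nat \<times> nat) list \<Rightarrow> nat \<Rightarrow> real" where
  "g_head h p es r = real (C_head h p es r) / p"

text \<open>The sum has finite support, since no counter exceeds the length of the stream.\<close>

definition head_estimator :: "(nat \<Rightarrow> real) \<Rightarrow> real \<Rightarrow> (nat \<times> nat) list \<Rightarrow> nat \<Rightarrow> real" where
  "head_estimator h p es d = (\<Sum>\<^sub>\<infinity>r\<in>{d..}. g_head h p es r)"

definition thr_degrees ::
    "real \<Rightarrow> real \<Rightarrow> nat \<Rightarrow> (nat \<Rightarrow> real) \<Rightarrow> real \<Rightarrow> (nat \<times> nat) list \<Rightarrow> nat set" where
  "thr_degrees c \<epsilon> n h p es =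
     {d. 1 \<le> d \<and> head_estimator h p es d \<ge> (c * ln (real n) / \<epsilon>\<^sup>2) / p}"

text \<open>
  For \<open>c > 0\<close> and \<open>n \<ge> 2\<close> the set of admissible degrees is finite, because the head estimator
  vanishes at all large degrees. If the set is empty, the value \<open>0\<close> encodes that no (positive)
  degree is at most the threshold.
\<close>

definition d_thr ::
    "real \<Rightarrow> real \<Rightarrow> nat \<Rightarrow> (nat \<Rightarrow> real) \<Rightarrow> real \<Rightarrow> (nat \<times> nat) list \<Rightarrow> nat" where
  "d_thr c \<epsilon> n h p es =
     (if thr_degrees c \<epsilon> n h p es = {} then 0 else Max (thr_degrees c \<epsilon> n h p es))"

text \<open>
  The estimate returned by the whole algorithm. The argument \<open>rest\<close> stands for the values that
  are output above the threshold.
\<close>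

definition estimate ::
    "(nat \<Rightarrow> real) \<Rightarrow> real \<Rightarrow> real \<Rightarrow> nat \<Rightarrow> (nat \<Rightarrow> real) \<Rightarrow> real \<Rightarrow> (nat \<times> nat) list \<Rightarrow> nat \<Rightarrow> real" where
  "estimate rest c \<epsilon> n h p es d =
     (if d \<le> d_thr c \<epsilon> n h p es then head_estimator h p es d else rest d)"

end

theory Submission imports Defs begin

text \<open>
  Whether a vertex is sampled depends only on its own hash value, and a sampled vertex is sampled
  at its first occurrence, so its counter is its full degree. Hence \<open>p\<close> times the head estimator
  at \<open>d\<close> is binomial with mean \<open>\<mu> = p N(d)\<close>. Write \<open>T = c ln n / \<epsilon>\<^sup>2\<close>. If \<open>\<mu> \<ge> T / 4\<close>, Chernoff's
  bounds make a relative error above \<open>\<epsilon>\<close> unlikely; if \<open>\<mu> < T / 4\<close>, they make it unlikely that the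
  count reaches \<open>T\<close>, which it does for every \<open>d\<close> up to the threshold because the estimator is
  antitone in \<open>d\<close>. A union bound over the at most \<open>n\<close> degrees finishes the proof.
\<close>

section \<open>The sampled counters\<close>

text \<open>Flattening the stream makes head sampling a fold over single vertex visits, in the order
  in which they are processed.\<close>

definition endpoints :: "(nat \<times> nat) list \<Rightarrow> nat list" where
  "endpoints es = concat (map (\<lambda>e. [fst e, snd e]) es)"

text \<open>The test \<open>h w < p\<close> has the same outcome at every visit, so \<open>w\<close>
  either enters at its first occurrence and has all occurrences counted, or never enters. Induction
  from the right matches \<open>fold\<close>, which performs the last visit last.\<close>

lemma fold_head_visit:
  "fold (head_visit h p) ws Map.empty w =
     (if h w < p \<and> w \<in> set ws then Some (count_list ws w) else None)"
  by (induction ws rule: rev_induct) (auto simp: head_visit_def split: option.splits)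

lemma fold_head_edge: "fold (head_edge h p) es st = fold (head_visit h p) (endpoints es) st"
  by (induction es arbitrary: st) (auto simp: endpoints_def head_edge_def)

lemma set_endpoints: "set (endpoints es) = \<Union>(edge_set es)"
  by (auto simp: endpoints_def edge_set_def uedge_def)

text \<open>Without loops, an edge contributes at most one occurrence of \<open>v\<close>.\<close>

lemma count_endpoints:
  assumes "\<forall>e\<in>set es. fst e \<noteq> snd e"
  shows "count_list (endpoints es) v = length (filter (\<lambda>e. v \<in> uedge e) es)"
  using assms by (induction es) (auto simp: endpoints_def uedge_def)

lemma vdegree_stream:
  assumes "distinct (map uedge es)"
  shows "vdegree (edge_set es) v = length (filter (\<lambda>e. v \<in> uedge e) es)"
proof -
  have "{e \<in> edge_set es. v \<in> e} = set (map uedge (filter (\<lambda>e. v \<in> uedge e) es))"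
    by (auto simp: edge_set_def)
  moreover have "distinct (map uedge (filter (\<lambda>e. v \<in> uedge e) es))"
    using assms by (rule distinct_map_filter)
  ultimately show ?thesis
    unfolding vdegree_def by (metis distinct_card length_map)
qed

lemma head_sample_eq:
  assumes "edge_stream n es"
  shows "head_sample h p es v =
    (if h v < p \<and> v \<in> {1..n} then Some (vdegree (edge_set es) v) else None)"
  using assms vdegree_stream[of es v] count_endpoints[of es v]
  unfolding head_sample_def fold_head_edge fold_head_visit edge_stream_def set_endpoints by simp

text \<open>Edges at \<open>v\<close> have the form \<open>{v, u}\<close> with \<open>u\<close> in
  \<open>{1..n}\<close>. This crude bound suffices to truncate the estimator's infinite sum and to
  leave only \<open>n\<close> degrees for the union bound.\<close>

lemma vdegree_le:
  assumes "edge_stream n es"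
  shows "vdegree (edge_set es) v \<le> n"
proof -
  have "{e \<in> edge_set es. v \<in> e} \<subseteq> (\<lambda>u. {v, u}) ` {1..n}"
  proof
    fix e assume e: "e \<in> {e \<in> edge_set es. v \<in> e}"
    then obtain x where x: "x \<in> set es" "e = {fst x, snd x}" "v = fst x \<or> v = snd x"
      by (auto simp: edge_set_def uedge_def)
    have "e \<subseteq> {1..n}" using e assms unfolding edge_stream_def by blast
    with x show "e \<in> (\<lambda>u. {v, u}) ` {1..n}" by (auto simp: insert_commute)
  qed
  hence "vdegree (edge_set es) v \<le> card ((\<lambda>u. {v, u}) ` {1..n})"
    unfolding vdegree_def by (rule card_mono[rotated]) simp
  also have "\<dots> \<le> n" using card_image_le[of "{1..n}" "\<lambda>u. {v, u}"] by simp
  finally show ?thesis .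
qed

definition high_vertices :: "nat \<Rightarrow> (nat \<times> nat) list \<Rightarrow> nat \<Rightarrow> nat set" where
  "high_vertices n es d = {v \<in> {1..n}. d \<le> vdegree (edge_set es) v}"

lemma high_vertices_subset: "high_vertices n es d \<subseteq> {1..n}"
  by (auto simp: high_vertices_def)

lemma N_ge_eq: "N_ge n (edge_set es) d = card (high_vertices n es d)"
  by (simp add: N_ge_def high_vertices_def)

lemma high_vertices_empty:
  assumes "edge_stream n es" "n < d"
  shows "high_vertices n es d = {}"
  using vdegree_le[OF assms(1)] assms(2) by (fastforce simp: high_vertices_def dest: le_trans)

text \<open>A sampled vertex is counted for exactly one \<open>r\<close>, its degree, so the classes
  \<open>?D r\<close> are disjoint and their sizes add up.\<close>

lemma head_estimator_eq:
  assumes "edge_stream n es"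
  shows "head_estimator h p es d = real (card {v \<in> high_vertices n es d. h v < p}) / p"
proof -
  let ?D = "\<lambda>r. {v \<in> {1..n}. h v < p \<and> vdegree (edge_set es) v = r}"
  have C: "C_head h p es r = card (?D r)" for r
    unfolding C_head_def head_sample_eq[OF assms] by (rule arg_cong[where f = card]) auto
  have "head_estimator h p es d = (\<Sum>\<^sub>\<infinity>r\<in>{d..n}. g_head h p es r)"
    unfolding head_estimator_def
    by (rule infsum_cong_neutral) (use vdegree_le[OF assms] in \<open>auto simp: g_head_def C\<close>)
  also have "\<dots> = (\<Sum>r\<in>{d..n}. real (card (?D r))) / p"
    by (simp add: g_head_def C sum_divide_distrib)
  also have "(\<Sum>r\<in>{d..n}. real (card (?D r))) = real (card (\<Union>r\<in>{d..n}. ?D r))"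
    by (subst card_UN_disjoint) auto
  also have "(\<Union>r\<in>{d..n}. ?D r) = {v \<in> high_vertices n es d. h v < p}"
    using vdegree_le[OF assms] by (auto simp: high_vertices_def)
  finally show ?thesis .
qed

section \<open>Monotonicity of the estimator and the random threshold\<close>

lemma head_estimator_antimono:
  assumes "edge_stream n es" "0 < p" "d \<le> d'"
  shows "head_estimator h p es d' \<le> head_estimator h p es d"
proof -
  have "finite (high_vertices n es d)"
    by (rule finite_subset[OF high_vertices_subset]) simp
  hence "card {v \<in> high_vertices n es d'. h v < p} \<le> card {v \<in> high_vertices n es d. h v < p}"
    using assms(3) by (intro card_mono) (auto simp: high_vertices_def)
  thus ?thesis
    using assms(2) by (simp add: head_estimator_eq[OF assms(1)] divide_right_mono)
qed

text \<open>Vertex 1 must be covered by an edge, whose two distinct endpoints lie in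
  \<open>{1..n}\<close>. This makes \<open>ln n\<close> strictly positive.\<close>

lemma edge_stream_ge_2:
  assumes "edge_stream n es" "1 \<le> n"
  shows "2 \<le> n"
proof -
  have "1 \<in> \<Union>(edge_set es)" using assms by (simp add: edge_stream_def)
  then obtain e where e: "e \<in> set es" by (auto simp: edge_set_def)
  have "{fst e, snd e} \<subseteq> \<Union>(edge_set es)"
    using e by (auto simp: edge_set_def uedge_def)
  hence "{fst e, snd e} \<subseteq> {1..n}" and "fst e \<noteq> snd e"
    using assms e by (auto simp: edge_stream_def)
  thus ?thesis by auto
qed

text \<open>Since the estimator is antitone, the degrees meeting the threshold inequality are
  downward closed among positive degrees. This replaces the random \<open>d_thr\<close> by an event
  about one fixed \<open>d\<close>.\<close>

lemma le_d_thr_iff: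
  assumes es: "edge_stream n es" and n: "1 \<le> n" and pos: "0 < c" "0 < \<epsilon>" "0 < p" and d: "1 \<le> d"
  shows "d \<le> d_thr c \<epsilon> n h p es \<longleftrightarrow> c * ln (real n) / \<epsilon>\<^sup>2 / p \<le> head_estimator h p es d"
proof -
  let ?S = "thr_degrees c \<epsilon> n h p es"
  \<comment> \<open>A positive threshold excludes all degrees above \<open>n\<close>, where the
    estimator is 0; hence \<open>?S\<close> is finite and its \<open>Max\<close> is
    meaningful.\<close>
  have "0 < c * ln (real n) / \<epsilon>\<^sup>2 / p"
    using edge_stream_ge_2[OF es n] pos by simp
  hence "d' \<notin> ?S" if "n < d'" for d'
    using high_vertices_empty[OF es that] by (simp add: thr_degrees_def head_estimator_eq[OF es])
  hence "?S \<subseteq> {..n}" using leI by blast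
  hence fin: "finite ?S" by (rule finite_subset) simp
  have S_iff: "d \<in> ?S \<longleftrightarrow> c * ln (real n) / \<epsilon>\<^sup>2 / p \<le> head_estimator h p es d"
    using d by (simp add: thr_degrees_def)
  have "d \<le> d_thr c \<epsilon> n h p es \<longleftrightarrow> d \<in> ?S"
  proof
    assume le: "d \<le> d_thr c \<epsilon> n h p es"
    \<comment> \<open>The default value 0 for empty \<open>?S\<close> is ruled out by
      \<open>1 \<le> d\<close>.\<close>
    hence ne: "?S \<noteq> {}" using d by (auto simp: d_thr_def)
    have "d_thr c \<epsilon> n h p es \<in> ?S"
      using Max_in[OF fin ne] ne by (simp add: d_thr_def)
    with head_estimator_antimono[OF es pos(3) le, of h] show "d \<in> ?S"
      unfolding S_iff by (simp add: thr_degrees_def)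
  next
    assume "d \<in> ?S"
    thus "d \<le> d_thr c \<epsilon> n h p es" using Max_ge[OF fin] by (auto simp: d_thr_def)
  qed
  thus ?thesis by (simp only: S_iff)
qed

section \<open>Chernoff bounds for the number of sampled vertices\<close>

abbreviation unif01 :: "real measure" where
  "unif01 \<equiv> uniform_measure lborel {0..1}"

lemma prob_space_unif01: "prob_space unif01"
  by (rule prob_space_uniform_measure) auto

lemma measure_unif01_less:
  assumes "0 < p" "p < 1"
  shows "measure unif01 {x. x < p} = p"
proof -
  have "{0..1} \<inter> {x. x < p} = {0..<p}" using assms by auto
  thus ?thesis using assms by (subst measure_uniform_measure) (auto simp: Int_commute)
qed

lemma prob_space_hash: "prob_space (hash_measure n)"
  unfolding hash_measure_def by (intro prob_space_PiM prob_space_unif01)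

lemma hash_component_measurable [measurable]:
  "v \<in> {1..n} \<Longrightarrow> (\<lambda>h. h v) \<in> borel_measurable (hash_measure n)"
proof -
  assume v: "v \<in> {1..n}"
  have "(\<lambda>h. h v) \<in> measurable (hash_measure n) unif01"
    unfolding hash_measure_def by (rule measurable_component_singleton[OF v])
  thus ?thesis by (simp cong: measurable_cong_sets)
qed

text \<open>Independence in the form needed here: Fubini on the product measure.\<close>

lemma expectation_prod_hash:
  fixes f :: "real \<Rightarrow> real"
  assumes A: "A \<subseteq> {1..n}" and f: "integrable unif01 f"
  shows "integrable (hash_measure n) (\<lambda>h. \<Prod>v\<in>A. f (h v))"
    and "integral\<^sup>L (hash_measure n) (\<lambda>h. \<Prod>v\<in>A. f (h v)) = integral\<^sup>L unif01 f ^ card A"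
proof -
  interpret U: prob_space unif01 by (rule prob_space_unif01)
  interpret P: product_sigma_finite "\<lambda>_::nat. unif01"
    by (simp add: product_sigma_finite_def U.sigma_finite_measure_axioms)
  \<comment> \<open>Padding with the constant 1, whose mean is 1, extends the product from
    \<open>A\<close> to the whole index set.\<close>
  let ?f = "\<lambda>v x. if v \<in> A then f x else 1"
  have int: "integrable unif01 (?f v)" for v
    using f by (cases "v \<in> A") simp_all
  have prod_f: "(\<Prod>v\<in>{1..n}. ?f v (h v)) = (\<Prod>v\<in>A. f (h v))" for h
    using A by (intro prod.mono_neutral_cong_right) auto
  show "integrable (hash_measure n) (\<lambda>h. \<Prod>v\<in>A. f (h v))"
    using P.product_integrable_prod[of "{1..n}" ?f] int
    unfolding hash_measure_def prod_f by simp
  have "integral\<^sup>L (hash_measure n) (\<lambda>h. \<Prod>v\<in>A. f (h v)) = (\<Prod>v\<in>{1..n}. integral\<^sup>L unif01 (?f v))"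
    using P.product_integral_prod[of "{1..n}" ?f] int
    unfolding hash_measure_def prod_f by simp
  also have "\<dots> = (\<Prod>v\<in>A. integral\<^sup>L unif01 f)"
    using A U.prob_space by (intro prod.mono_neutral_cong_right) auto
  finally show "integral\<^sup>L (hash_measure n) (\<lambda>h. \<Prod>v\<in>A. f (h v)) = integral\<^sup>L unif01 f ^ card A"
    by simp
qed

text \<open>For \<open>A = high_vertices n es d\<close> this is \<open>p\<close> times the head
  estimator at \<open>d\<close>; the tail bounds are proved for arbitrary \<open>A\<close> inside
  \<open>{1..n}\<close>.\<close>

definition sampled :: "real \<Rightarrow> nat set \<Rightarrow> (nat \<Rightarrow> real) \<Rightarrow> real" where
  "sampled p A h = real (card {v \<in> A. h v < p})"

lemma sampled_eq_sum:
  "finite A \<Longrightarrow> sampled p A h = (\<Sum>v\<in>A. indicator {x. x < p} (h v))"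
  by (simp add: sampled_def indicator_def sum.If_cases Int_def)

lemma sampled_measurable:
  assumes "A \<subseteq> {1..n}"
  shows "sampled p A \<in> borel_measurable (hash_measure n)"
proof -
  have "finite A" using assms finite_subset by blast
  hence eq: "sampled p A = (\<lambda>h. \<Sum>v\<in>A. indicator {x. x < p} (h v))"
    by (simp add: sampled_eq_sum fun_eq_iff)
  have "(\<lambda>h. indicator {x. x < p} (h v) :: real) \<in> borel_measurable (hash_measure n)"
    if "v \<in> A" for v
  proof -
    have "v \<in> {1..n}" using that assms by auto
    note [measurable] = hash_component_measurable[OF this]
    show ?thesis by measurable
  qed
  thus ?thesis unfolding eq by (rule borel_measurable_sum)
qed

lemma expectation_sampled:
  fixes p :: real
  assumes p: "0 < p" "p < 1" and A: "A \<subseteq> {1..n}"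
  shows "integrable (hash_measure n) (sampled p A)"
    and "integral\<^sup>L (hash_measure n) (sampled p A) = p * card A"
proof -
  interpret U: prob_space unif01 by (rule prob_space_unif01)
  have "finite A" using A finite_subset by blast
  hence eq: "sampled p A = (\<lambda>h. \<Sum>v\<in>A. indicator {x. x < p} (h v))"
    by (simp add: sampled_eq_sum fun_eq_iff)
  have f: "integrable unif01 (indicator {x. x < p} :: real \<Rightarrow> real)"
    by (intro integrable_real_indicator) (auto simp: U.emeasure_eq_measure)
  \<comment> \<open>One indicator is a product over the singleton \<open>{v}\<close>.\<close>
  have single: "integrable (hash_measure n) (\<lambda>h. indicator {x. x < p} (h v) :: real)"
    "integral\<^sup>L (hash_measure n) (\<lambda>h. indicator {x. x < p} (h v)) = p" if "v \<in> A" for v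
    using expectation_prod_hash[of "{v}", OF _ f, of n] that A measure_unif01_less[OF p] by auto
  show "integrable (hash_measure n) (sampled p A)"
    unfolding eq using single by (intro Bochner_Integration.integrable_sum) auto
  show "integral\<^sup>L (hash_measure n) (sampled p A) = p * card A"
    unfolding eq using single by (subst Bochner_Integration.integral_sum) auto
qed

text \<open>The binomial moment generating function \<open>(1 + (exp t - 1) * p) ^ card A\<close> is
  bounded by the Poisson one through \<open>1 + x \<le> exp x\<close>.\<close>

lemma exp_sampled:
  fixes p t :: real
  assumes p: "0 < p" "p < 1" and A: "A \<subseteq> {1..n}"
  shows "integrable (hash_measure n) (\<lambda>h. exp (t * sampled p A h))"
    and "integral\<^sup>L (hash_measure n) (\<lambda>h. exp (t * sampled p A h)) \<le> exp (p * card A * (exp t - 1))"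
proof -
  interpret U: prob_space unif01 by (rule prob_space_unif01)
  \<comment> \<open>This is \<open>exp (t * indicator {x. x < p} x)\<close> written affinely in the
    indicator, so that its mean follows by linearity.\<close>
  let ?f = "\<lambda>x. 1 + (exp t - 1) * indicator {x. x < p} x :: real"
  have fin: "finite A" using A finite_subset by blast
  have exp_eq: "exp (t * sampled p A h) = (\<Prod>v\<in>A. ?f (h v))" for h
    unfolding sampled_eq_sum[OF fin] sum_distrib_left exp_sum[OF fin]
    by (intro prod.cong) (auto simp: indicator_def)
  have ind: "integrable unif01 (indicator {x. x < p} :: real \<Rightarrow> real)"
    by (intro integrable_real_indicator) (auto simp: U.emeasure_eq_measure)
  hence f: "integrable unif01 ?f" by simp
  have If: "integral\<^sup>L unif01 ?f = 1 + (exp t - 1) * p"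
    using ind U.prob_space measure_unif01_less[OF p] by simp
  show "integrable (hash_measure n) (\<lambda>h. exp (t * sampled p A h))"
    unfolding exp_eq by (rule expectation_prod_hash(1)[OF A f])
  have "integral\<^sup>L (hash_measure n) (\<lambda>h. exp (t * sampled p A h)) = (1 + (exp t - 1) * p) ^ card A"
    unfolding exp_eq expectation_prod_hash(2)[OF A f] If ..
  also have "\<dots> \<le> exp ((exp t - 1) * p) ^ card A"
  proof (rule power_mono)
    \<comment> \<open>For negative \<open>t\<close> the base is still nonnegative, being a convex
      combination of 1 and \<open>exp t\<close>.\<close>
    have "0 \<le> (1 - p) + exp t * p" using p by simp
    thus "0 \<le> 1 + (exp t - 1) * p" by (simp add: algebra_simps)
  qed (rule exp_ge_add_one_self)
  also have "\<dots> = exp (p * card A * (exp t - 1))"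
    by (simp add: exp_of_nat_mult[symmetric] algebra_simps)
  finally show "integral\<^sup>L (hash_measure n) (\<lambda>h. exp (t * sampled p A h))
    \<le> exp (p * card A * (exp t - 1))" .
qed

text \<open>Positive \<open>t\<close> gives upper tails and negative \<open>t\<close> gives lower tails.\<close>

lemma sampled_tail:
  fixes p t a :: real
  assumes p: "0 < p" "p < 1" and A: "A \<subseteq> {1..n}"
  shows "measure (hash_measure n) {h \<in> space (hash_measure n). t * a \<le> t * sampled p A h}
    \<le> exp (p * card A * (exp t - 1) - t * a)"
proof -
  have "measure (hash_measure n) {h \<in> space (hash_measure n). t * a \<le> t * sampled p A h}
      = measure (hash_measure n) {h \<in> space (hash_measure n). exp (t * a) \<le> exp (t * sampled p A h)}"
    by simp
  also have "\<dots> \<le> integral\<^sup>L (hash_measure n) (\<lambda>h. exp (t * sampled p A h)) / exp (t * a)"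
    by (rule integral_Markov_inequality_measure[where A = "{}"])
      (use exp_sampled(1)[OF p A] in auto)
  also have "\<dots> \<le> exp (p * card A * (exp t - 1)) / exp (t * a)"
    by (intro divide_right_mono exp_sampled(2)[OF p A]) simp
  finally show ?thesis by (simp add: exp_diff)
qed

lemma exp_le_quadratic:
  fixes t :: real
  assumes "t \<le> 1"
  shows "exp t \<le> 1 + t + t\<^sup>2"
proof (cases "0 \<le> t")
  case True
  thus ?thesis using exp_bound assms by blast
next
  case False
  \<comment> \<open>The product equals \<open>1 - t ^ 3\<close>, which exceeds 1 for negative
    \<open>t\<close>; then \<open>1 - t\<close> is replaced by the larger
    \<open>exp (- t)\<close>.\<close>
  have "1 \<le> (1 - t) * (1 + t + t\<^sup>2)"
    using False by (simp add: algebra_simps power2_eq_square mult_nonpos_nonneg zero_le_mult_iff)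
  also have "\<dots> \<le> exp (- t) * (1 + t + t\<^sup>2)"
  proof (rule mult_right_mono)
    have "1 + t + t\<^sup>2 = (t + 1 / 2)\<^sup>2 + 3 / 4" by (simp add: power2_eq_square algebra_simps)
    thus "0 \<le> 1 + t + t\<^sup>2" by simp
  qed (use exp_ge_add_one_self[of "- t"] in simp)
  finally show ?thesis by (simp add: exp_minus field_simps)
qed

text \<open>For \<open>t = \<epsilon> / 2\<close> and \<open>t = - (\<epsilon> / 2)\<close> the
  level \<open>\<mu> + 2 * t * \<mu>\<close> is \<open>(1 + \<epsilon>) * \<mu>\<close> and
  \<open>(1 - \<epsilon>) * \<mu>\<close>, so one computation treats both tails. These
  \<open>t\<close> minimize the exponent once \<open>exp t - 1\<close> is replaced by
  \<open>t + t\<^sup>2\<close>.\<close>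

lemma sampled_deviation:
  fixes p :: real
  assumes p: "0 < p" "p < 1" and A: "A \<subseteq> {1..n}" and \<epsilon>: "0 < \<epsilon>" "\<epsilon> < 1"
  defines "\<mu> \<equiv> p * card A"
  shows "measure (hash_measure n) {h \<in> space (hash_measure n). \<epsilon> * \<mu> < \<bar>sampled p A h - \<mu>\<bar>}
    \<le> 2 * exp (- (\<epsilon>\<^sup>2 * \<mu> / 4))"
proof -
  interpret prob_space "hash_measure n" by (rule prob_space_hash)
  note [measurable] = sampled_measurable[OF A]
  have \<mu>: "0 \<le> \<mu>" using p by (simp add: \<mu>_def)
  let ?E = "\<lambda>t a. {h \<in> space (hash_measure n). t * a \<le> t * sampled p A h}"
  have tail: "prob (?E t (\<mu> + 2 * t * \<mu>)) \<le> exp (- (\<epsilon>\<^sup>2 * \<mu> / 4))" if t: "\<bar>t\<bar> = \<epsilon> / 2" for t :: real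
  proof -
    have "t\<^sup>2 = \<epsilon>\<^sup>2 / 4" using power2_abs[of t] by (simp add: t power_divide)
    have "\<mu> * (exp t - 1) - t * (\<mu> + 2 * t * \<mu>) \<le> \<mu> * (t + t\<^sup>2) - t * (\<mu> + 2 * t * \<mu>)"
    proof (intro diff_right_mono mult_left_mono)
      have "t \<le> 1" using t \<epsilon> by linarith
      thus "exp t - 1 \<le> t + t\<^sup>2" using exp_le_quadratic by fastforce
    qed (rule \<mu>)
    also have "\<dots> = - (t\<^sup>2 * \<mu>)" by (simp add: algebra_simps power2_eq_square)
    finally show ?thesis
      using order_trans[OF sampled_tail[OF p A, of t "\<mu> + 2 * t * \<mu>", folded \<mu>_def]]
        \<open>t\<^sup>2 = \<epsilon>\<^sup>2 / 4\<close> by simp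
  qed
  have "prob {h \<in> space (hash_measure n). \<epsilon> * \<mu> < \<bar>sampled p A h - \<mu>\<bar>}
      \<le> prob (?E (\<epsilon> / 2) (\<mu> + 2 * (\<epsilon> / 2) * \<mu>) \<union> ?E (- (\<epsilon> / 2)) (\<mu> + 2 * (- (\<epsilon> / 2)) * \<mu>))"
    using \<epsilon> by (intro finite_measure_mono) (auto simp: abs_if split: if_splits)
  also have "\<dots> \<le> prob (?E (\<epsilon> / 2) (\<mu> + 2 * (\<epsilon> / 2) * \<mu>))
      + prob (?E (- (\<epsilon> / 2)) (\<mu> + 2 * (- (\<epsilon> / 2)) * \<mu>))"
    by (rule measure_Un_le) measurable
  also have "\<dots> \<le> 2 * exp (- (\<epsilon>\<^sup>2 * \<mu> / 4))"
    using tail[of "\<epsilon> / 2"] tail[of "- (\<epsilon> / 2)"] \<epsilon> by simp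
  finally show ?thesis .
qed

lemma sampled_large:
  fixes p :: real
  assumes p: "0 < p" "p < 1" and A: "A \<subseteq> {1..n}" and T: "p * card A \<le> T / 4"
  shows "measure (hash_measure n) {h \<in> space (hash_measure n). T \<le> sampled p A h} \<le> exp (- (T / 2))"
proof -
  \<comment> \<open>The choice \<open>t = 1\<close> and the bound \<open>exp 1 \<le> 3\<close> give
    an exponent of at most \<open>T / 2 - T\<close>.\<close>
  have "p * card A * (exp 1 - 1) \<le> p * card A * 2"
    using exp_bound[of 1] p by (intro mult_left_mono) auto
  also have "\<dots> \<le> T / 2" using T by simp
  finally show ?thesis
    using order_trans[OF sampled_tail[OF p A, of 1 T]] by simp
qed

text \<open>The bad event needs both a count of at least \<open>T\<close> and a large deviation. For
  a small mean the first is unlikely, otherwise the second is. The bound \<open>1 / n ^ 3\<close>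
  leaves room for a union over \<open>n\<close> degrees.\<close>

lemma sampled_bad_event:
  fixes p :: real
  assumes p: "0 < p" "p < 1" and A: "A \<subseteq> {1..n}" and \<epsilon>: "0 < \<epsilon>" "\<epsilon> < 1"
    and c: "64 \<le> c" and n: "2 \<le> n"
  shows "measure (hash_measure n) {h \<in> space (hash_measure n).
      c * ln (real n) / \<epsilon>\<^sup>2 \<le> sampled p A h \<and>
      \<epsilon> * (p * card A) < \<bar>sampled p A h - p * card A\<bar>} \<le> 1 / real n ^ 3"
    (is "measure _ ?B \<le> _")
proof -
  interpret prob_space "hash_measure n" by (rule prob_space_hash)
  note [measurable] = sampled_measurable[OF A]
  define T where "T = c * ln (real n) / \<epsilon>\<^sup>2"
  \<comment> \<open>The constant comes from the large-mean case: a mean above \<open>T / 4\<close>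
    gives the exponent \<open>\<epsilon>\<^sup>2 * T / 16\<close>, which has to reach
    \<open>4 * ln n\<close>.\<close>
  have "64 * ln (real n) \<le> c * ln (real n)" using c n by (intro mult_right_mono) auto
  moreover have "\<epsilon>\<^sup>2 * T = c * ln (real n)" using \<epsilon> by (simp add: T_def)
  ultimately have T: "64 * ln (real n) \<le> \<epsilon>\<^sup>2 * T" by simp
  have "0 \<le> T" using c n by (simp add: T_def)
  moreover have "\<epsilon>\<^sup>2 \<le> 1" using \<epsilon> by (simp add: power_le_one)
  ultimately have "\<epsilon>\<^sup>2 * T \<le> T" using mult_right_mono by fastforce
  have "prob ?B \<le> 2 * exp (- (4 * ln (real n)))"
  proof (cases "p * card A \<le> T / 4")
    case True
    have "prob ?B \<le> prob {h \<in> space (hash_measure n). T \<le> sampled p A h}"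
      by (intro finite_measure_mono) (auto simp: T_def)
    also have "\<dots> \<le> exp (- (T / 2))" by (rule sampled_large[OF p A True])
    also have "\<dots> \<le> exp (- (4 * ln (real n)))"
    proof -
      have "0 \<le> ln (real n)" using n by simp
      \<comment> \<open>There is slack here: \<open>T\<close> is even at least
        \<open>64 * ln n\<close>.\<close>
      hence "8 * ln (real n) \<le> T" using T \<open>\<epsilon>\<^sup>2 * T \<le> T\<close> by linarith
      thus ?thesis by simp
    qed
    finally show ?thesis by (smt (verit) exp_gt_zero)
  next
    case False
    hence "\<epsilon>\<^sup>2 * (T / 4) \<le> \<epsilon>\<^sup>2 * (p * card A)" by (intro mult_left_mono) auto
    hence "4 * ln (real n) \<le> \<epsilon>\<^sup>2 * (p * card A) / 4" using T by simp
    have "prob ?B \<le> prob {h \<in> space (hash_measure n).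
        \<epsilon> * (p * card A) < \<bar>sampled p A h - p * card A\<bar>}"
      by (intro finite_measure_mono) auto
    also have "\<dots> \<le> 2 * exp (- (\<epsilon>\<^sup>2 * (p * card A) / 4))" by (rule sampled_deviation[OF p A \<epsilon>])
    also have "\<dots> \<le> 2 * exp (- (4 * ln (real n)))"
      using \<open>4 * ln (real n) \<le> \<epsilon>\<^sup>2 * (p * card A) / 4\<close> by simp
    finally show ?thesis .
  qed
  also have "exp (- (4 * ln (real n))) = 1 / real n ^ 4"
  proof -
    have "exp (4 * ln (real n)) = real n ^ 4" using exp_of_nat_mult[of 4 "ln (real n)"] n by simp
    thus ?thesis by (simp add: exp_minus divide_inverse)
  qed
  \<comment> \<open>The two-sided factor 2 is absorbed by one factor \<open>n\<close>, as
    \<open>2 \<le> n\<close>.\<close>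
  also have "2 * (1 / real n ^ 4) \<le> 1 / real n ^ 3"
    using n by (simp add: field_simps power_numeral_reduce)
  finally show ?thesis .
qed

section \<open>Unbiasedness and the union bound over all degrees\<close>

theorem lemma5:
  "\<exists>c0::real. c0 > 0 \<and>
    (\<forall>c \<ge> c0. \<forall>(\<epsilon>::real) (p::real) (n::nat) (es :: (nat \<times> nat) list).
       0 < \<epsilon> \<and> \<epsilon> < 1 \<and> 0 < p \<and> p < 1 \<and> 1 \<le> n \<and> edge_stream n es \<longrightarrow>
         (\<forall>h \<in> space (hash_measure n). \<forall>rest. \<forall>d \<ge> 1. d \<le> d_thr c \<epsilon> n h p es \<longrightarrow>
            estimate rest c \<epsilon> n h p es d = head_estimator h p es d) \<and>
         (\<forall>d \<ge> 1.
            integrable (hash_measure n) (\<lambda>h. head_estimator h p es d) \<and>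
            integral\<^sup>L (hash_measure n) (\<lambda>h. head_estimator h p es d)
              = real (N_ge n (edge_set es) d)) \<and>
         measure (hash_measure n)
           {h \<in> space (hash_measure n). \<forall>d \<ge> 1. d \<le> d_thr c \<epsilon> n h p es \<longrightarrow>
              \<bar>head_estimator h p es d - real (N_ge n (edge_set es) d)\<bar>
                \<le> \<epsilon> * real (N_ge n (edge_set es) d)}
           > 1 - 1 / real n)"
proof (intro exI[of _ 64] conjI allI impI ballI)
  fix c \<epsilon> p :: real and n :: nat and es :: "(nat \<times> nat) list"
  assume c: "64 \<le> c"
    and hyps: "0 < \<epsilon> \<and> \<epsilon> < 1 \<and> 0 < p \<and> p < 1 \<and> 1 \<le> n \<and> edge_stream n es"
  hence \<epsilon>: "0 < \<epsilon>" "\<epsilon> < 1" and p: "0 < p" "p < 1" and n1: "1 \<le> n" and es: "edge_stream n es"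
    by auto
  have n: "2 \<le> n" by (rule edge_stream_ge_2[OF es n1])
  let ?M = "hash_measure n" and ?A = "high_vertices n es"
  have est: "head_estimator h p es d = sampled p (?A d) h / p" for h d
    by (simp add: head_estimator_eq[OF es] sampled_def)
  {
    fix h d and rest :: "nat \<Rightarrow> real"
    assume "d \<le> d_thr c \<epsilon> n h p es"
    thus "estimate rest c \<epsilon> n h p es d = head_estimator h p es d"
      by (simp add: estimate_def)
  next
    fix d
    show "integrable ?M (\<lambda>h. head_estimator h p es d)"
      unfolding est using expectation_sampled(1)[OF p high_vertices_subset] by simp
    show "integral\<^sup>L ?M (\<lambda>h. head_estimator h p es d) = real (N_ge n (edge_set es) d)"
      unfolding est N_ge_eq using expectation_sampled(2)[OF p high_vertices_subset, of n es d] p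
      by simp
  next
    interpret prob_space ?M by (rule prob_space_hash)
    define good where "good = {h \<in> space ?M. \<forall>d \<ge> 1. d \<le> d_thr c \<epsilon> n h p es \<longrightarrow>
        \<bar>head_estimator h p es d - real (N_ge n (edge_set es) d)\<bar>
          \<le> \<epsilon> * real (N_ge n (edge_set es) d)}"
    define bad where "bad d = {h \<in> space ?M. c * ln (real n) / \<epsilon>\<^sup>2 \<le> sampled p (?A d) h \<and>
        \<epsilon> * (p * card (?A d)) < \<bar>sampled p (?A d) h - p * card (?A d)\<bar>}" for d
    have bad_sets: "bad d \<in> sets ?M" for d
    proof -
      note [measurable] = sampled_measurable[OF high_vertices_subset[of n es d]]
      show ?thesis unfolding bad_def by measurable
    qed
    \<comment> \<open>Relative error is unchanged when count and mean are both divided by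
      \<open>p\<close>.\<close>
    have deviation_iff: "\<epsilon> * (p * card (?A d)) < \<bar>sampled p (?A d) h - p * card (?A d)\<bar> \<longleftrightarrow>
        \<epsilon> * real (N_ge n (edge_set es) d)
          < \<bar>head_estimator h p es d - real (N_ge n (edge_set es) d)\<bar>" for h d
    proof -
      have "sampled p (?A d) h - p * card (?A d) = p * (sampled p (?A d) h / p - card (?A d))"
        using p by (simp add: field_simps)
      thus ?thesis using p by (simp add: est N_ge_eq abs_mult mult.left_commute[of \<epsilon>])
    qed
    have le_thr: "d \<le> d_thr c \<epsilon> n h p es \<longleftrightarrow> c * ln (real n) / \<epsilon>\<^sup>2 \<le> sampled p (?A d) h"
      if "1 \<le> d" for d h
      using le_d_thr_iff[OF es n1 _ \<epsilon>(1) p(1) that] c p unfolding est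
      by (simp add: divide_le_cancel del: divide_divide_eq_left)
    have "good = space ?M - (\<Union>d\<in>{1..}. bad d)"
      unfolding good_def bad_def deviation_iff using le_thr by (auto simp: not_le)
    \<comment> \<open>Above degree \<open>n\<close> both count and mean are 0, so the strict
      deviation fails and the union over all degrees becomes finite.\<close>
    moreover have "bad d = {}" if "\<not> d \<le> n" for d
      using high_vertices_empty[OF es, of d] that by (auto simp: bad_def sampled_def)
    hence "(\<Union>d\<in>{1..}. bad d) = (\<Union>d\<in>{1..n}. bad d)"
      by (auto simp del: not_le) (metis atLeastAtMost_iff empty_iff)
    ultimately have good: "good = space ?M - (\<Union>d\<in>{1..n}. bad d)" by simp
    have "prob (\<Union>d\<in>{1..n}. bad d) \<le> (\<Sum>d\<in>{1..n}. prob (bad d))"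
      using bad_sets by (intro finite_measure_subadditive_finite) auto
    also have "\<dots> \<le> (\<Sum>d\<in>{1..n}. 1 / real n ^ 3)"
      unfolding bad_def by (intro sum_mono sampled_bad_event[OF p high_vertices_subset \<epsilon> c n])
    \<comment> \<open>The sum is \<open>1 / n ^ 2\<close>; with \<open>2 \<le> n\<close> this gives
      the strict inequality of the claim.\<close>
    also have "\<dots> < 1 / real n" using n by (simp add: field_simps power_numeral_reduce)
    finally have "1 - 1 / real n < prob good"
      unfolding good using bad_sets by (subst prob_compl) auto
    thus "1 - 1 / real n < measure ?M {h \<in> space ?M. \<forall>d \<ge> 1. d \<le> d_thr c \<epsilon> n h p es \<longrightarrow>
        \<bar>head_estimator h p es d - real (N_ge n (edge_set es) d)\<bar>
          \<le> \<epsilon> * real (N_ge n (edge_set es) d)}"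
      unfolding good_def .
  }
qed simp

end
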